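(* For every integer $n \ge 0$ and every $x$, $$\sum_{k=0}^n s(n,k)\, E_k(x) = n! \sum_{k=0}^n \binom{x}{k}\left(-\frac12\right)^{n-k},$$ $$E_n(x) = \sum_{k=0}^n S(n,k)\, k! \left\{\sum_{j=0}^k \binom{x}{j}\left(-\frac12\right)^{k-j}\right\}.$$
   Context: $s(n,k)$ are the signed Stirling numbers of the first kind ($x(x-1)\cdots(x-n+1)=\sum_k s(n,k)x^k$) and $S(n,k)$ are the Stirling numbers of the second kind. The Euler polynomials $E_n(x)$ are defined by $\frac{2e^{xt}}{e^t+1} = \sum_{n\ge0} E_n(x)\frac{t^n}{n!}$. $\binom{x}{k} = x(x-1)\cdots(x-k+1)/k!$. *)

theory Defs
  imports
    Complex_Main
    "HOL-Computational_Algebra.Computational_Algebra"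
    "HOL-Combinatorics.Stirling"
begin

text \<open>
  The library constant \<^const>\<open>stirling\<close> is the unsigned Stirling number of the first kind; the
  signed number is read off from the falling factorial as a polynomial. Stirling numbers of the
  second kind are the library constant \<^const>\<open>Stirling\<close>.
\<close>

definition signed_stirling :: "nat \<Rightarrow> nat \<Rightarrow> int" where
  "signed_stirling n k = poly.coeff (\<Prod>i<n. [:- int i, 1:]) k"

text \<open>
  The generating function is taken as a formal power series in the variable \<open>t\<close>; the constant
  coefficient of the denominator is 2, so the quotient is a genuine one in characteristic 0.
\<close>

definition euler_poly :: "nat \<Rightarrow> 'a::field_char_0 \<Rightarrow> 'a" where
  "euler_poly n x = fact n * fps_nth (2 * fps_exp x / (fps_exp 1 + 1)) n"

lemma euler_poly_generating_function:
  fixes x :: "'a::field_char_0"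
  shows "Abs_fps (\<lambda>n. euler_poly n x / fact n) = 2 * fps_exp x / (fps_exp 1 + 1)"
  by (rule fps_ext) (simp add: euler_poly_def)

lemma falling_factorial_eq_sum_signed_stirling:
  fixes x :: "'a::comm_ring_1"
  shows "(\<Prod>i<n. x - of_nat i) = (\<Sum>k\<le>n. of_int (signed_stirling n k) * x ^ k)"
proof -
  let ?p = "\<Prod>i<n. [:- int i, 1:]"
  have deg: "degree ?p \<le> n"
  proof (induction n)
    case (Suc n)
    have "degree (\<Prod>i<Suc n. [:- int i, 1:]) \<le> degree (\<Prod>i<n. [:- int i, 1:]) + degree [:- int n, 1:]"
      unfolding prod.lessThan_Suc by (rule degree_mult_le)
    with Suc.IH show ?case by simp
  qed simp
  have "poly (map_poly of_int ?p) x = (\<Prod>i<n. x - of_nat i)"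
  proof (induction n)
    case (Suc n)
    have *: "map_poly of_int (p * q) = map_poly of_int p * (map_poly of_int q :: 'a poly)"
      for p q :: "int poly"
      by (rule poly_eqI) (simp add: coeff_map_poly coeff_mult)
    show ?case
      unfolding prod.lessThan_Suc * poly_mult Suc.IH by (simp add: map_poly_pCons)
  qed simp
  moreover have "poly (map_poly of_int ?p) x
      = (\<Sum>k\<le>n. poly.coeff (map_poly of_int ?p) k * x ^ k)"
    unfolding poly_altdef
    by (rule sum.mono_neutral_left)
      (use deg in \<open>auto simp: coeff_eq_0 intro: order.trans[OF map_poly_degree_leq]\<close>)
  ultimately show ?thesis
    by (simp add: signed_stirling_def coeff_map_poly)
qed

end

theory Submission
  imports Defs
begin

text \<open>
  Umbral argument: let \<open>L\<close> be the linear functional on polynomials in \<open>y\<close> with \<open>L (y ^ k) = E\<^sub>k(x)\<close>.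
  Multiplying the generating function by \<open>e\<^sup>t + 1\<close> gives \<open>L (p(y + 1)) + L (p(y)) = 2 p(x)\<close>. For the
  falling factorials \<open>(y)\<^sub>n\<close>, whose forward difference is \<open>n (y)\<^sub>n\<^sub>-\<^sub>1\<close>, this is the recurrence
  \<open>2 L (y)\<^sub>n + n L (y)\<^sub>n\<^sub>-\<^sub>1 = 2 (x)\<^sub>n\<close>, which the right-hand side of the first formula also satisfies.
  The two formulas result from applying \<open>L\<close> to the expansion of \<open>(y)\<^sub>n\<close> in powers of \<open>y\<close> and to the
  expansion of \<open>y ^ n\<close> in falling factorials.
\<close>

text \<open>Coefficient of \<open>t ^ n\<close> in
  \<open>F * (fps_exp 1 + 1) = 2 * fps_exp x\<close>, scaled by \<open>fact n\<close>. This is the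
  case \<open>p = monom 1 n\<close> of the shift identity for the functional.\<close>

lemma sum_binomial_euler_poly:
  fixes x :: "'a::field_char_0"
  shows "(\<Sum>j\<le>n. of_nat (n choose j) * euler_poly j x) + euler_poly n x = 2 * x ^ n"
proof -
  define F where "F = 2 * fps_exp x / (fps_exp 1 + 1 :: 'a fps)"
  have "(fps_exp 1 + 1 :: 'a fps) $ 0 \<noteq> 0"
    by simp
  then have "F * (fps_exp 1 + 1) = 2 * fps_exp x"
    unfolding F_def by (simp add: fps_divide_unit mult.assoc inverse_mult_eq_1)
  then have "(F * fps_exp 1 + F) $ n = (fps_const 2 * fps_exp x) $ n"
    by (simp only: distrib_left mult_1_right numeral_fps_const)
  also have "\<dots> = 2 * (x ^ n / fact n)"
    by (simp only: fps_mult_left_const_nth fps_exp_nth of_nat_fact)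
  finally have "(\<Sum>j\<le>n. F $ j / fact (n - j)) + F $ n = 2 * x ^ n / fact n"
    by (simp add: fps_mult_nth atLeast0AtMost)
  then have "fact n * ((\<Sum>j\<le>n. F $ j / fact (n - j)) + F $ n) = 2 * x ^ n"
    by simp
  moreover have "fact n * (F $ j / fact (n - j)) = of_nat (n choose j) * euler_poly j x"
    if "j \<le> n" for j
    using that by (simp add: euler_poly_def F_def binomial_fact field_simps)
  ultimately show ?thesis
    by (simp add: distrib_left sum_distrib_left euler_poly_def F_def)
qed

definition euler_functional :: "'a::field_char_0 \<Rightarrow> 'a poly \<Rightarrow> 'a" where
  "euler_functional x p = (\<Sum>k\<le>degree p. coeff p k * euler_poly k x)"

text \<open>Coefficients beyond the degree vanish, so polynomials of different degrees can be summed
  over one common range; linearity rests on this.\<close>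

lemma euler_functional_eq_sum:
  assumes "degree p \<le> n"
  shows "euler_functional x p = (\<Sum>k\<le>n. coeff p k * euler_poly k x)"
  unfolding euler_functional_def
  by (rule sum.mono_neutral_left) (use assms in \<open>auto simp: coeff_eq_0\<close>)

lemma euler_functional_0 [simp]: "euler_functional x 0 = 0"
  by (simp add: euler_functional_def)

lemma euler_functional_add:
  "euler_functional x (p + q) = euler_functional x p + euler_functional x q"
proof -
  let ?n = "max (degree p) (degree q)"
  have "degree (p + q) \<le> ?n" "degree p \<le> ?n" "degree q \<le> ?n"
    by (simp_all add: degree_add_le)
  then show ?thesis
    by (simp add: euler_functional_eq_sum[where n = ?n] distrib_right sum.distrib)
qed

lemma euler_functional_smult: "euler_functional x (smult c p) = c * euler_functional x p"
  by (simp add: euler_functional_eq_sum[OF degree_smult_le] euler_functional_def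
      sum_distrib_left mult.assoc)

lemma euler_functional_sum:
  "euler_functional x (\<Sum>i\<in>A. f i) = (\<Sum>i\<in>A. euler_functional x (f i))"
  by (induction A rule: infinite_finite_induct) (simp_all add: euler_functional_add)

lemma euler_functional_monom: "euler_functional x (monom 1 n) = euler_poly n x"
  by (simp add: euler_functional_eq_sum[OF degree_monom_le] if_distrib if_distribR
      cong: if_cong)

lemma linear_factor_power_eq_sum_monom:
  "[:1, 1:] ^ n = (\<Sum>j\<le>n. smult (of_nat (n choose j)) (monom 1 j) :: 'a::comm_ring_1 poly)"
proof -
  have "[:1, 1:] = monom 1 1 + (1 :: 'a poly)"
    by (simp add: monom_altdef one_pCons)
  then have "[:1, 1:] ^ n = (\<Sum>j\<le>n. of_nat (n choose j) * (monom 1 1 :: 'a poly) ^ j)"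
    by (simp add: binomial_ring)
  then show ?thesis
    by (simp add: monom_power of_nat_poly)
qed

lemma pcompose_monom_1: "monom 1 n \<circ>\<^sub>p q = (q :: 'a::comm_ring_1 poly) ^ n"
  by (induction n) (simp_all add: monom_Suc pcompose_pCons pcompose_1)

text \<open>Composition with \<open>[:1, 1:]\<close> is \<open>p(y + 1)\<close>. Both sides are
  linear in \<open>p\<close>, so monomials suffice, and there the binomial theorem reduces the claim
  to \<open>sum_binomial_euler_poly\<close>.\<close>

lemma euler_functional_shift:
  "euler_functional x (p \<circ>\<^sub>p [:1, 1:]) + euler_functional x p = 2 * poly p x"
proof -
  let ?L = "euler_functional x"
  have monom: "?L ([:1, 1:] ^ n) + ?L (monom 1 n) = 2 * x ^ n" for n
    unfolding linear_factor_power_eq_sum_monom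
    by (simp add: euler_functional_sum euler_functional_smult euler_functional_monom
        sum_binomial_euler_poly)
  have p: "p = (\<Sum>k\<le>degree p. smult (coeff p k) (monom 1 k))"
    by (simp add: smult_monom poly_as_sum_of_monoms)
  have "p \<circ>\<^sub>p [:1, 1:] = (\<Sum>k\<le>degree p. smult (coeff p k) ([:1, 1:] ^ k))"
    by (subst p) (simp add: pcompose_sum pcompose_smult pcompose_monom_1)
  then have "?L (p \<circ>\<^sub>p [:1, 1:]) + ?L p
      = (\<Sum>k\<le>degree p. coeff p k * (?L ([:1, 1:] ^ k) + ?L (monom 1 k)))"
    by (subst (2) p)
      (simp add: euler_functional_sum euler_functional_smult distrib_left sum.distrib)
  also have "\<dots> = 2 * poly p x"
    by (simp add: monom poly_altdef sum_distrib_left mult_ac)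
  finally show ?thesis .
qed

text \<open>The integer polynomial behind \<open>signed_stirling\<close>, taken over
  \<open>'a\<close> so that the functional applies to it.\<close>

definition falling_fact_poly :: "nat \<Rightarrow> 'a::comm_ring_1 poly" where
  "falling_fact_poly n = (\<Prod>i<n. [:- of_nat i, 1:])"

lemma falling_fact_poly_Suc:
  "falling_fact_poly (Suc n) = [:- of_nat n, 1:] * falling_fact_poly n"
  by (simp add: falling_fact_poly_def mult.commute)

text \<open>Multiplication by \<open>y - n\<close> gives both sides the same recurrence; it links
  the coefficients at \<open>k\<close> and \<open>k - 1\<close>, hence \<open>k\<close> is arbitrary
  in the induction.\<close>

lemma coeff_falling_fact_poly:
  "coeff (falling_fact_poly n) k = of_int (signed_stirling n k)"
proof (induction n arbitrary: k)
  case 0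
  then show ?case
    by (simp add: falling_fact_poly_def signed_stirling_def)
next
  case (Suc n)
  have "signed_stirling (Suc n) k
      = - int n * signed_stirling n k + (case k of 0 \<Rightarrow> 0 | Suc j \<Rightarrow> signed_stirling n j)"
    unfolding signed_stirling_def prod.lessThan_Suc
    by (simp add: mult.commute[of _ "[:- int n, 1:]"] coeff_pCons split: nat.split)
  then show ?case
    by (simp add: falling_fact_poly_Suc Suc.IH coeff_pCons split: nat.split)
qed

lemma degree_falling_fact_poly_le: "degree (falling_fact_poly n) \<le> n"
proof (induction n)
  case (Suc n)
  then show ?case
    unfolding falling_fact_poly_Suc
    using degree_mult_le[of "[:- of_nat n, 1:]" "falling_fact_poly n :: 'a poly"] by simp
qed (simp add: falling_fact_poly_def)

lemma poly_falling_fact_poly: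
  fixes x :: "'a::field_char_0"
  shows "poly (falling_fact_poly n) x = fact n * (x gchoose n)"
  by (simp add: falling_fact_poly_def poly_prod gbinomial_mult_fact atLeast0LessThan)

text \<open>The shift turns the factor for \<open>i = 0\<close> into \<open>y + 1\<close> and the
  factor for \<open>Suc i\<close> into the one for \<open>i\<close>. Splitting
  \<open>y + 1 = (y - n) + (n + 1)\<close> then gives the two terms.\<close>

lemma pcompose_falling_fact_poly_Suc:
  "falling_fact_poly (Suc n) \<circ>\<^sub>p [:1, 1:]
    = falling_fact_poly (Suc n) + smult (of_nat (Suc n)) (falling_fact_poly n :: 'a::comm_ring_1 poly)"
proof -
  have "falling_fact_poly (Suc n) \<circ>\<^sub>p [:1, 1:] = [:1, 1:] * (falling_fact_poly n :: 'a poly)"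
    unfolding falling_fact_poly_def prod.lessThan_Suc_shift
    by (simp add: pcompose_mult pcompose_prod pcompose_pCons)
  also have "[:1, 1:] = [:- of_nat n, 1:] + [:of_nat (Suc n) :: 'a:]"
    by simp
  finally show ?thesis
    by (simp add: falling_fact_poly_Suc smult_add_left algebra_simps)
qed

text \<open>Multiplying by \<open>y\<close> sends \<open>?f k\<close> to
  \<open>?f (Suc k) + k * ?f k\<close>, which reproduces the recurrence of
  \<open>Stirling\<close>.\<close>

lemma monom_eq_sum_Stirling_falling_fact_poly:
  "monom 1 n = (\<Sum>k\<le>n. smult (of_nat (Stirling n k)) (falling_fact_poly k :: 'a::comm_ring_1 poly))"
proof (induction n)
  case 0
  then show ?case
    by (simp add: falling_fact_poly_def)
next
  case (Suc n)
  let ?f = "falling_fact_poly :: nat \<Rightarrow> 'a poly"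
  have y_mult: "[:0, 1:] * ?f k = ?f (Suc k) + smult (of_nat k) (?f k)" for k
    by (simp add: falling_fact_poly_Suc)
  have "monom 1 (Suc n) = [:0, 1:] * (monom 1 n :: 'a poly)"
    by (simp add: monom_Suc)
  also have "\<dots> = (\<Sum>k\<le>n. smult (of_nat (Stirling n k)) ([:0, 1:] * ?f k))"
    unfolding Suc.IH by (simp only: sum_distrib_left mult_smult_right)
  also have "\<dots> = (\<Sum>k\<le>n. smult (of_nat (Stirling n k)) (?f (Suc k)))
      + (\<Sum>k\<le>n. smult (of_nat (k * Stirling n k)) (?f k))"
    unfolding y_mult by (simp add: smult_add_right sum.distrib mult.commute)
  \<comment> \<open>The added term is zero as \<open>Stirling n (Suc n) = 0\<close>; the factor
    \<open>k\<close> then kills the term at 0, so the index can be shifted.\<close>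
  also have "(\<Sum>k\<le>n. smult (of_nat (k * Stirling n k)) (?f k))
      = (\<Sum>k\<le>Suc n. smult (of_nat (k * Stirling n k)) (?f k))"
    by simp
  also have "\<dots> = (\<Sum>k\<le>n. smult (of_nat (Suc k * Stirling n (Suc k))) (?f (Suc k)))"
    by (subst sum.atMost_Suc_shift) simp
  also have "(\<Sum>k\<le>n. smult (of_nat (Stirling n k)) (?f (Suc k))) + \<dots>
      = (\<Sum>k\<le>n. smult (of_nat (Stirling (Suc n) (Suc k))) (?f (Suc k)))"
    by (simp add: sum.distrib[symmetric] smult_add_left[symmetric] add_ac)
  also have "\<dots> = (\<Sum>k\<le>Suc n. smult (of_nat (Stirling (Suc n) k)) (?f k))"
    by (subst sum.atMost_Suc_shift) simp
  finally show ?case .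
qed

lemma euler_functional_falling_fact_poly:
  "euler_functional x (falling_fact_poly n)
    = fact n * (\<Sum>k\<le>n. (x gchoose k) * (- (1/2)) ^ (n - k))"
proof (induction n)
  case 0
  \<comment> \<open>For \<open>n = 0\<close> both summands of the identity are
    \<open>euler_poly 0 x\<close>.\<close>
  have "2 * euler_poly 0 x = 2"
    using sum_binomial_euler_poly[of 0 x] by simp
  then show ?case
    by (simp add: euler_functional_def falling_fact_poly_def)
next
  case (Suc n)
  let ?L = "euler_functional x" and ?S = "\<lambda>n. \<Sum>k\<le>n. (x gchoose k) * (- (1/2)) ^ (n - k)"
  have "2 * ?L (falling_fact_poly (Suc n)) + of_nat (Suc n) * ?L (falling_fact_poly n)
      = 2 * (fact (Suc n) * (x gchoose Suc n))"
    using euler_functional_shift[of x "falling_fact_poly (Suc n)"]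
    unfolding pcompose_falling_fact_poly_Suc euler_functional_add euler_functional_smult
      poly_falling_fact_poly
    by (simp add: algebra_simps)
  then have "?L (falling_fact_poly (Suc n))
      = fact (Suc n) * (x gchoose Suc n) - of_nat (Suc n) * (fact n * ?S n) / 2"
    unfolding Suc.IH by (simp add: field_simps)
  also have "\<dots> = fact (Suc n) * ((x gchoose Suc n) - ?S n / 2)"
    by (simp add: algebra_simps)
  \<comment> \<open>The factor \<open>- (1/2)\<close> raises each exponent \<open>n - k\<close> to
    \<open>Suc n - k\<close>; the new top term has exponent 0.\<close>
  also have "(x gchoose Suc n) - ?S n / 2 = ?S (Suc n)"
    by (simp add: Suc_diff_le sum_divide_distrib sum_negf)
  finally show ?case .
qed

theorem theorem3:
  fixes n :: nat and x :: "'a::field_char_0"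
  shows "(\<Sum>k=0..n. of_int (signed_stirling n k) * euler_poly k x)
           = fact n * (\<Sum>k=0..n. (x gchoose k) * (- (1/2)) ^ (n - k))
       \<and> euler_poly n x
           = (\<Sum>k=0..n. of_nat (Stirling n k) * fact k
                * (\<Sum>j=0..k. (x gchoose j) * (- (1/2)) ^ (k - j)))"
proof
  show "(\<Sum>k=0..n. of_int (signed_stirling n k) * euler_poly k x)
      = fact n * (\<Sum>k=0..n. (x gchoose k) * (- (1/2)) ^ (n - k))"
    using euler_functional_falling_fact_poly[of x n]
    by (simp add: euler_functional_eq_sum[OF degree_falling_fact_poly_le]
        coeff_falling_fact_poly atLeast0AtMost)
  have "euler_poly n x
      = (\<Sum>k\<le>n. of_nat (Stirling n k) * euler_functional x (falling_fact_poly k))"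
    unfolding euler_functional_monom[symmetric] monom_eq_sum_Stirling_falling_fact_poly
      euler_functional_sum euler_functional_smult ..
  then show "euler_poly n x = (\<Sum>k=0..n. of_nat (Stirling n k) * fact k
      * (\<Sum>j=0..k. (x gchoose j) * (- (1/2)) ^ (k - j)))"
    by (simp add: euler_functional_falling_fact_poly atLeast0AtMost mult.assoc)
qed

end
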